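(* Let $(N,\mathcal{A},u)$ be an incave game and let $S\subset\mathcal{A}$ be a connected set. Then the set $\lambda^k(S)$ of $S,k$-rationalizable actions is connected for all $k\in\mathbb{N}$.
   Context: An $n$-player game is a tuple $(N,\mathcal{A},u)$ with players $N=\{1,\dots,n\}$, joint action space $\mathcal{A}=\prod_{i=1}^n A_i$ with $A_i=\mathbb{R}^{n_i}$, $n_i\in\mathbb{N}$, and utilities $u=(u_1,\dots,u_n)$, $u_i:\mathcal{A}\to\mathbb{R}$. Write $a_{-i}$ for the actions of all players except $i$, and $\mathrm{BR}_i(a_{-i})=\arg\max_{a_i\in A_i}u_i(a_i,a_{-i})$. A differentiable function $g:\mathbb{R}^m\to\mathbb{R}$ is invex if every stationary point is a global minimum; it is incave if $-g$ is invex. $g$ is decreasing at infinity if for every $x$ there is a compact set $K$ with $g(z)<g(x)$ for all $z\notin K$. The game is incave if for every $i\in N$, the utility $u_i$ is incave in $a_i$ and decreasing at infinity with respect to $a_i$ (i.e. for every $a_{-i}$, the function $u_i(\cdot,a_{-i})$ is incave and decreasing at infinity). For $S\subset\mathcal{A}$, the joint best response map is $\lambda(S)=\prod_{i=1}^n\bigcup_{a\in S}\mathrm{BR}_i(\pi_{-i}(a))$, where $\pi_{-i}$ projects a joint action onto the actions of all players except $i$. Recursively, $\lambda^1=\lambda$ and $\lambda^k(S)=\lambda(\lambda^{k-1}(S))$; $\lambda^k(S)$ is the set of $S,k$-rationalizable actions. The empty set is regarded as connected.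
   Formalization: The formal version adds that each utility is jointly continuous on the joint action space and continuously differentiable (not merely differentiable) in the player's own action; without either assumption the claim is false. *)

theory Defs
  imports "HOL-Analysis.Analysis"
begin

text \<open>
  The dimensions \<open>n\<^sub>i\<close> of the action spaces may differ between players, so player \<open>i\<close>'s action
  space \<open>\<real>\<^sup>n\<^sup>i\<close> is taken as the coordinate space of a set \<open>I i\<close> of \<open>n\<^sub>i\<close> indices, inside one ambient
  space \<open>real ^ 'm\<close>.  Since \<open>'m\<close> and \<open>I\<close> are arbitrary, all finite families of dimensions occur.
  The players are the elements of the finite type \<open>'n\<close>.
\<close>

definition coord_space :: "'m set \<Rightarrow> (real ^ 'm) set" where
  "coord_space J = {x. \<forall>j. j \<notin> J \<longrightarrow> x $ j = 0}"

definition joint_actions :: "('n \<Rightarrow> 'm set) \<Rightarrow> ('n \<Rightarrow> real ^ 'm) set" where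
  "joint_actions I = Pi UNIV (\<lambda>i. coord_space (I i))"

text \<open>
  In the next definitions \<open>E\<close> is a linear subspace, so \<open>at x within E\<close> gives the ordinary Frechet
  derivative of a function on the Euclidean space \<open>E\<close>: only the values of a derivative on \<open>E\<close>
  matter, and \<open>x\<close> is stationary iff the zero map is a derivative there.
\<close>

definition stationary_on :: "'a::euclidean_space set \<Rightarrow> ('a \<Rightarrow> real) \<Rightarrow> 'a \<Rightarrow> bool" where
  "stationary_on E g x \<longleftrightarrow> x \<in> E \<and> (g has_derivative (\<lambda>h. 0)) (at x within E)"

definition invex_on :: "'a::euclidean_space set \<Rightarrow> ('a \<Rightarrow> real) \<Rightarrow> bool" where
  "invex_on E g \<longleftrightarrow>
     g differentiable_on E \<and> (\<forall>x. stationary_on E g x \<longrightarrow> (\<forall>z\<in>E. g x \<le> g z))"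

definition incave_on :: "'a::euclidean_space set \<Rightarrow> ('a \<Rightarrow> real) \<Rightarrow> bool" where
  "incave_on E g \<longleftrightarrow> invex_on E (\<lambda>x. - g x)"

definition decreasing_at_infinity_on :: "'a::euclidean_space set \<Rightarrow> ('a \<Rightarrow> real) \<Rightarrow> bool" where
  "decreasing_at_infinity_on E g \<longleftrightarrow>
     (\<forall>x\<in>E. \<exists>K. K \<subseteq> E \<and> compact K \<and> (\<forall>z\<in>E - K. g z < g x))"

definition continuously_differentiable_on :: "'a::euclidean_space set \<Rightarrow> ('a \<Rightarrow> real) \<Rightarrow> bool" where
  "continuously_differentiable_on E g \<longleftrightarrow>
     (\<exists>G. continuous_on E G \<and> (\<forall>x\<in>E. (g has_derivative (\<lambda>h. G x \<bullet> h)) (at x within E)))"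

text \<open>
  The joint action \<open>(x, a\<^sub>-\<^sub>i)\<close> is \<open>a(i := x)\<close>.  Functions of \<open>a\<^sub>-\<^sub>i\<close> are written as functions of \<open>a\<close>
  that do not depend on \<open>a i\<close>.
\<close>

definition incave_game ::
  "('n::finite \<Rightarrow> 'm::finite set) \<Rightarrow> ('n \<Rightarrow> ('n \<Rightarrow> real ^ 'm) \<Rightarrow> real) \<Rightarrow> bool" where
  "incave_game I u \<longleftrightarrow>
     (\<forall>i. \<forall>a\<in>joint_actions I.
        incave_on (coord_space (I i)) (\<lambda>x. u i (a(i := x))) \<and>
        decreasing_at_infinity_on (coord_space (I i)) (\<lambda>x. u i (a(i := x))))"

definition best_response ::
  "('n::finite \<Rightarrow> 'm::finite set) \<Rightarrow> ('n \<Rightarrow> ('n \<Rightarrow> real ^ 'm) \<Rightarrow> real) \<Rightarrow>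
   'n \<Rightarrow> ('n \<Rightarrow> real ^ 'm) \<Rightarrow> (real ^ 'm) set" where
  "best_response I u i a =
     {x \<in> coord_space (I i). \<forall>y\<in>coord_space (I i). u i (a(i := y)) \<le> u i (a(i := x))}"

definition joint_best_response ::
  "('n::finite \<Rightarrow> 'm::finite set) \<Rightarrow> ('n \<Rightarrow> ('n \<Rightarrow> real ^ 'm) \<Rightarrow> real) \<Rightarrow>
   ('n \<Rightarrow> real ^ 'm) set \<Rightarrow> ('n \<Rightarrow> real ^ 'm) set" where
  "joint_best_response I u S = Pi UNIV (\<lambda>i. \<Union>a\<in>S. best_response I u i a)"

definition rationalizable ::
  "('n::finite \<Rightarrow> 'm::finite set) \<Rightarrow> ('n \<Rightarrow> ('n \<Rightarrow> real ^ 'm) \<Rightarrow> real) \<Rightarrow>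
   ('n \<Rightarrow> real ^ 'm) set \<Rightarrow> nat \<Rightarrow> ('n \<Rightarrow> real ^ 'm) set" where
  "rationalizable I u S k = (joint_best_response I u ^^ k) S"

end

theory Submission
  imports Defs
begin

text \<open>
  Connected, nonempty values together with upper hemicontinuity make the union of the best responses
  over a connected set connected, and products of connected sets are connected.  That the set of
  maximisers of an incave function decreasing at infinity is connected is a mountain pass argument:
  two separated maximisers would produce a critical point below the maximum.  The same rigidity gives
  upper hemicontinuity without uniformity at infinity: a local maximiser is a global one, so near a
  given opponent profile the connected set of best responses is trapped in a bounded neighbourhood.
\<close>

section \<open>Local descent at regular points of a continuously differentiable function\<close>

text \<open>Subtracting the linear part at \<open>p\<close> leaves the gradient
  \<open>G x - G p\<close>, which continuity makes small near \<open>p\<close>; the mean value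
  inequality applies because \<open>E\<close> meets a ball in a convex set.\<close>

lemma strict_derivative_on_convex:
  fixes f :: "'a::real_inner \<Rightarrow> real"
  assumes E: "convex E" and G: "continuous_on E G"
    and deriv: "\<And>x. x \<in> E \<Longrightarrow> (f has_derivative (\<lambda>h. G x \<bullet> h)) (at x within E)"
    and p: "p \<in> E" and "\<eta> > 0"
  shows "\<exists>\<delta>>0. \<forall>x\<in>E \<inter> ball p \<delta>. \<forall>y\<in>E \<inter> ball p \<delta>.
    \<bar>f y - f x - G p \<bullet> (y - x)\<bar> \<le> \<eta> * norm (y - x)"
proof -
  obtain \<delta> where "\<delta> > 0" and \<delta>: "\<And>x. x \<in> E \<Longrightarrow> dist x p < \<delta> \<Longrightarrow> dist (G x) (G p) < \<eta>"
    using G p \<open>\<eta> > 0\<close> unfolding continuous_on_iff by metis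
  have "\<bar>f y - f x - G p \<bullet> (y - x)\<bar> \<le> \<eta> * norm (y - x)"
    if xy: "x \<in> E \<inter> ball p \<delta>" "y \<in> E \<inter> ball p \<delta>" for x y
  proof -
    define g where "g = (\<lambda>z. f z - G p \<bullet> z)"
    have "norm (g y - g x) \<le> \<eta> * norm (y - x)"
    proof (rule differentiable_bound)
      show "convex (E \<inter> ball p \<delta>)"
        using E by (intro convex_Int convex_ball)
      fix z assume z: "z \<in> E \<inter> ball p \<delta>"
      have "(f has_derivative (\<lambda>h. G z \<bullet> h)) (at z within E \<inter> ball p \<delta>)"
        using deriv z by (blast intro: has_derivative_subset)
      then show "(g has_derivative (\<lambda>h. G z \<bullet> h - G p \<bullet> h)) (at z within E \<inter> ball p \<delta>)"
        unfolding g_def by (auto intro!: derivative_eq_intros)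
      have "norm (G z - G p) \<le> \<eta>"
        using \<delta>[of z] z by (force simp: dist_norm norm_minus_commute)
      then show "onorm (\<lambda>h. G z \<bullet> h - G p \<bullet> h) \<le> \<eta>"
      proof (intro onorm_bound)
        fix h assume "norm (G z - G p) \<le> \<eta>"
        have "norm (G z \<bullet> h - G p \<bullet> h) \<le> norm (G z - G p) * norm h"
          by (metis inner_diff_left Cauchy_Schwarz_ineq2 real_norm_def)
        also have "\<dots> \<le> \<eta> * norm h"
          using \<open>norm (G z - G p) \<le> \<eta>\<close> by (intro mult_right_mono) auto
        finally show "norm (G z \<bullet> h - G p \<bullet> h) \<le> \<eta> * norm h" .
      qed (use \<open>\<eta> > 0\<close> in auto)
    qed (use xy in auto)
    then show ?thesis
      by (simp add: g_def inner_diff_right algebra_simps)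
  qed
  with \<open>\<delta> > 0\<close> show ?thesis by blast
qed

text \<open>A derivative within \<open>E\<close> only sees \<open>v\<close> on \<open>E\<close>:
  were \<open>v\<close> orthogonal to \<open>E\<close>, the zero map would be a derivative too. As
  \<open>E\<close> is a subspace, the sign of \<open>w\<close> can be flipped.\<close>

lemma nonstationary_direction:
  fixes f :: "'a::euclidean_space \<Rightarrow> real"
  assumes E: "subspace E" and p: "p \<in> E"
    and deriv: "(f has_derivative (\<lambda>h. v \<bullet> h)) (at p within E)"
    and nonstat: "\<not> (f has_derivative (\<lambda>h. 0)) (at p within E)"
  obtains w where "w \<in> E" "v \<bullet> w > 0"
proof -
  have "\<exists>w\<in>E. v \<bullet> w \<noteq> 0"
  proof (rule ccontr)
    assume "\<not> (\<exists>w\<in>E. v \<bullet> w \<noteq> 0)"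
    then have *: "v \<bullet> (y - p) = 0" if "y \<in> E" for y
      using subspace_diff[OF E that p] by blast
    have "(f has_derivative (\<lambda>h. 0)) (at p within E)"
      using deriv * unfolding has_derivative_within_alt by simp
    with nonstat show False by blast
  qed
  then obtain w where "w \<in> E" "v \<bullet> w \<noteq> 0" by blast
  then show ?thesis
    using that[of w] that[of "- w"] E by (cases "v \<bullet> w > 0") (auto simp: subspace_neg)
qed

text \<open>
  Near a regular point \<open>p\<close>, every point below the level of \<open>p\<close> can be moved along one fixed
  descent direction into a common ball below that level.
\<close>

lemma strict_sublevel_near_regular_point:
  fixes f :: "'a::euclidean_space \<Rightarrow> real"
  assumes E: "subspace E" and G: "continuous_on E G"
    and deriv: "\<And>x. x \<in> E \<Longrightarrow> (f has_derivative (\<lambda>h. G x \<bullet> h)) (at x within E)"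
    and p: "p \<in> E" and nonstat: "\<not> (f has_derivative (\<lambda>h. 0)) (at p within E)"
  obtains \<epsilon> T where "\<epsilon> > 0" "connected T" "T \<subseteq> {x\<in>E. f x < f p}"
    "{x\<in>E. f x < f p} \<inter> ball p \<epsilon> \<subseteq> T" "p \<in> closure T"
proof -
  obtain w where w: "w \<in> E" and m: "G p \<bullet> w > 0"
    using nonstationary_direction[OF E p deriv[OF p] nonstat] .
  then have nw: "norm w > 0" by auto
  define m where "m = G p \<bullet> w"
  \<comment> \<open>Moving by \<open>s\<close> times \<open>w\<close> changes \<open>f\<close> by
    \<open>s * m\<close> to first order; this \<open>\<eta>\<close> caps the error at half of
    that.\<close>
  define \<eta> where "\<eta> = m / (2 * norm w)"
  have "m > 0" "\<eta> > 0" using m nw by (auto simp: m_def \<eta>_def)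
  have \<eta>w: "\<eta> * norm w = m / 2" using nw by (simp add: \<eta>_def)
  obtain \<delta> where "\<delta> > 0" and \<delta>: "\<And>x y. x \<in> E \<inter> ball p \<delta> \<Longrightarrow> y \<in> E \<inter> ball p \<delta> \<Longrightarrow>
      \<bar>f y - f x - G p \<bullet> (y - x)\<bar> \<le> \<eta> * norm (y - x)"
    using strict_derivative_on_convex[OF subspace_imp_convex[OF E] G deriv p \<open>\<eta> > 0\<close>] by blast
  \<comment> \<open>Steps of length at most \<open>\<delta> / 2\<close> that start within
    \<open>\<delta> / 2\<close> of \<open>p\<close> stay in \<open>ball p \<delta>\<close>.\<close>
  define t where "t = \<delta> / (2 * norm w)"
  have "t > 0" and tw: "t * norm w = \<delta> / 2" using nw \<open>\<delta> > 0\<close> by (auto simp: t_def)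
  define L where "L = norm (G p) + \<eta>"
  have "L > 0" using \<open>\<eta> > 0\<close> by (auto simp: L_def add_nonneg_pos)
  \<comment> \<open>\<open>L\<close> bounds the growth rate of \<open>f\<close> in
    \<open>ball p \<delta>\<close>. The first bound keeps descents inside that ball; the second
    makes a shift by \<open>\<epsilon>\<close> cost at most \<open>t * m / 2\<close>, the drop
    guaranteed by a full descent.\<close>
  define \<epsilon> where "\<epsilon> = min (\<delta> / 2) (t * m / (2 * L))"
  have "\<epsilon> > 0" using \<open>\<delta> > 0\<close> \<open>t > 0\<close> \<open>m > 0\<close> \<open>L > 0\<close> by (simp add: \<epsilon>_def)
  have "L * \<epsilon> \<le> L * (t * m / (2 * L))"
    using \<open>L > 0\<close> by (intro mult_left_mono) (auto simp: \<epsilon>_def)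
  then have L\<epsilon>: "L * \<epsilon> \<le> t * m / 2" using \<open>L > 0\<close> by simp
  have near: "x - s *\<^sub>R w \<in> E \<inter> ball p \<delta>" if "x \<in> E \<inter> ball p \<epsilon>" "0 \<le> s" "s \<le> t" for x s
  proof -
    have "norm (s *\<^sub>R w) \<le> \<delta> / 2"
      using that tw mult_right_mono[of s t "norm w", OF _ norm_ge_zero] by (metis abs_of_nonneg norm_scaleR)
    moreover have "norm (p - x) < \<delta> / 2" using that by (auto simp: dist_norm \<epsilon>_def)
    moreover have "norm (p - (x - s *\<^sub>R w)) \<le> norm (p - x) + norm (s *\<^sub>R w)"
      using norm_triangle_ineq[of "p - x" "s *\<^sub>R w"] by (simp add: algebra_simps)
    ultimately show ?thesis
      using that w E by (auto simp: dist_norm subspace_diff subspace_scale)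
  qed
  have descent: "f (x - s *\<^sub>R w) \<le> f x - s * m / 2" if "x \<in> E \<inter> ball p \<epsilon>" "0 \<le> s" "s \<le> t" for x s
  proof -
    have "\<bar>f (x - s *\<^sub>R w) - f x - G p \<bullet> (x - s *\<^sub>R w - x)\<bar> \<le> \<eta> * norm (x - s *\<^sub>R w - x)"
      using \<delta> near[OF that] near[of x 0] that by force
    moreover have "\<eta> * norm (x - s *\<^sub>R w - x) = s * (m / 2)"
      using \<open>0 \<le> s\<close> \<eta>w by (simp add: mult.left_commute)
    moreover have "G p \<bullet> (x - s *\<^sub>R w - x) = - (s * m)" by (simp add: m_def)
    ultimately have "f (x - s *\<^sub>R w) - f x + s * m \<le> s * (m / 2)" by linarith
    then show ?thesis by (simp add: field_simps)
  qed
  define q where "q = p - t *\<^sub>R w"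
  have q: "f x < f p" if "x \<in> E \<inter> ball q \<epsilon>" for x
  proof -
    have xq: "norm (x - q) < \<epsilon>" using that by (simp add: dist_norm norm_minus_commute)
    have pq: "p \<in> E \<inter> ball p \<epsilon>" using p \<open>\<epsilon> > 0\<close> by simp
    have "norm (p - x) \<le> norm (t *\<^sub>R w) + norm (x - q)"
      using norm_triangle_ineq4[of "t *\<^sub>R w" "x - q"] by (simp add: q_def algebra_simps)
    then have "norm (p - x) < \<delta>" using xq tw \<open>t > 0\<close> by (simp add: \<epsilon>_def)
    then have "x \<in> E \<inter> ball p \<delta>" using that by (simp add: dist_norm)
    moreover have qd: "q \<in> E \<inter> ball p \<delta>"
      using near[OF pq] \<open>t > 0\<close> by (simp add: q_def)
    ultimately have "\<bar>f x - f q - G p \<bullet> (x - q)\<bar> \<le> \<eta> * norm (x - q)" using \<delta> by blast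
    moreover have "G p \<bullet> (x - q) \<le> norm (G p) * norm (x - q)" by (rule norm_cauchy_schwarz)
    ultimately have "f x \<le> f q + L * norm (x - q)" by (simp add: L_def distrib_right)
    also have "\<dots> < f q + L * \<epsilon>" using xq \<open>L > 0\<close> by simp
    also have "f q \<le> f p - t * m / 2" using descent[OF pq] \<open>t > 0\<close> by (simp add: q_def)
    finally show ?thesis using L\<epsilon> by simp
  qed
  \<comment> \<open>Translation by \<open>- t *\<^sub>R w\<close> carries \<open>A\<close> into
    \<open>B\<close>, so every segment in \<open>T\<close> ends in the convex set \<open>B\<close>;
    along the segments \<open>descent\<close> keeps \<open>f\<close> below
    \<open>f p\<close>.\<close>
  define A where "A = {x\<in>E. f x < f p} \<inter> ball p \<epsilon>"
  define B where "B = E \<inter> ball q \<epsilon>"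
  define T where "T = B \<union> (\<Union>x\<in>A. closed_segment x (x - t *\<^sub>R w))"
  have seg: "\<exists>s. 0 \<le> s \<and> s \<le> t \<and> y = x - s *\<^sub>R w" if y: "y \<in> closed_segment x (x - t *\<^sub>R w)" for x y
  proof -
    obtain r where "0 \<le> r" "r \<le> 1" and yr: "y = (1 - r) *\<^sub>R x + r *\<^sub>R (x - t *\<^sub>R w)"
      using y unfolding in_segment by blast
    have "y = x - (r * t) *\<^sub>R w" unfolding yr by (simp add: scaleR_diff_left scaleR_diff_right)
    moreover have "0 \<le> r * t" "r * t \<le> t"
      using mult_left_le_one_le[of t r] \<open>t > 0\<close> \<open>0 \<le> r\<close> \<open>r \<le> 1\<close> by simp_all
    ultimately show ?thesis by blast
  qed
  show ?thesis
  proof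
    show "\<epsilon> > 0" by fact
    have "connected (B \<union> closed_segment x (x - t *\<^sub>R w))" if "x \<in> A" for x
    proof (rule connected_Un)
      show "connected B" unfolding B_def
        using E by (intro convex_connected convex_Int convex_ball subspace_imp_convex)
      have "x - t *\<^sub>R w \<in> B"
        using that w E by (auto simp: A_def B_def q_def dist_norm subspace_diff subspace_scale)
      then show "B \<inter> closed_segment x (x - t *\<^sub>R w) \<noteq> {}" by auto
    qed auto
    moreover have "q \<in> B"
      using \<open>\<epsilon> > 0\<close> p w E by (auto simp: B_def q_def subspace_diff subspace_scale)
    moreover have "connected B" unfolding B_def
      using E by (intro convex_connected convex_Int convex_ball subspace_imp_convex)
    ultimately have "connected (\<Union>(insert B ((\<lambda>x. B \<union> closed_segment x (x - t *\<^sub>R w)) ` A)))"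
      by (intro connected_Union) auto
    moreover have "\<Union>(insert B ((\<lambda>x. B \<union> closed_segment x (x - t *\<^sub>R w)) ` A)) = T"
      by (auto simp: T_def)
    ultimately show "connected T" by simp
    have "y \<in> E \<and> f y < f p" if xA: "x \<in> A" and y: "y \<in> closed_segment x (x - t *\<^sub>R w)" for x y
    proof -
      obtain s where s: "0 \<le> s" "s \<le> t" "y = x - s *\<^sub>R w" using seg[OF y] by blast
      have x: "x \<in> E \<inter> ball p \<epsilon>" "f x < f p" using xA by (auto simp: A_def)
      have "s * m / 2 \<ge> 0" using s \<open>m > 0\<close> by simp
      then show ?thesis using descent[OF x(1) s(1,2)] near[OF x(1) s(1,2)] s x by auto
    qed
    then show "T \<subseteq> {x\<in>E. f x < f p}" using q by (auto simp: T_def B_def)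
    show "{x\<in>E. f x < f p} \<inter> ball p \<epsilon> \<subseteq> T"
      unfolding T_def A_def by auto
    show "p \<in> closure T" unfolding closure_approachable
    proof (intro allI impI)
      fix e :: real assume "e > 0"
      \<comment> \<open>Short enough to end within \<open>e\<close> of \<open>p\<close> and still
        inside \<open>ball p \<epsilon>\<close>, so that the point reached belongs to
        \<open>A\<close>.\<close>
      define s where "s = min t (min e \<epsilon> / (2 * norm w))"
      have "s > 0" "s \<le> t" using \<open>e > 0\<close> \<open>\<epsilon> > 0\<close> \<open>t > 0\<close> nw by (auto simp: s_def)
      have "s * norm w \<le> min e \<epsilon> / (2 * norm w) * norm w"
        by (intro mult_right_mono) (auto simp: s_def)
      also have "\<dots> = min e \<epsilon> / 2" using nw by simp
      also have "\<dots> < min e \<epsilon>" using \<open>e > 0\<close> \<open>\<epsilon> > 0\<close> by (auto simp: min_def)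
      finally have sw: "s * norm w < e" "s * norm w < \<epsilon>" by auto
      have pq: "p \<in> E \<inter> ball p \<epsilon>" using p \<open>\<epsilon> > 0\<close> by simp
      have "f (p - s *\<^sub>R w) < f p"
        using descent[OF pq, of s] \<open>s > 0\<close> \<open>s \<le> t\<close> \<open>m > 0\<close>
        by (smt (verit) half_gt_zero mult_pos_pos)
      then have "p - s *\<^sub>R w \<in> A"
        using near[OF pq, of s] sw \<open>s > 0\<close> \<open>s \<le> t\<close> by (auto simp: A_def dist_norm)
      then have "p - s *\<^sub>R w \<in> T" by (auto simp: T_def)
      moreover have "dist (p - s *\<^sub>R w) p < e" using sw \<open>s > 0\<close> by (simp add: dist_norm)
      ultimately show "\<exists>y\<in>T. dist y p < e" by blast
    qed
  qed
qed

section \<open>Mountain pass argument: connectedness of the set of minimisers\<close>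

text \<open>Deleting the points at level \<open>c\<close> cannot disconnect the component: near each
  of them the strict sublevel set lies in one connected piece adherent to that point, so a
  separation of the strict part would extend by closures to the whole component.\<close>

lemma connected_strict_sublevel_component:
  fixes f :: "'a::metric_space \<Rightarrow> real"
  assumes regular: "\<And>p. p \<in> E \<Longrightarrow> f p = c \<Longrightarrow> \<exists>\<epsilon> T. \<epsilon> > 0 \<and> connected T \<and> T \<subseteq> {x\<in>E. f x < c} \<and>
      {x\<in>E. f x < c} \<inter> ball p \<epsilon> \<subseteq> T \<and> p \<in> closure T"
  shows "connected (connected_component_set {x\<in>E. f x \<le> c} a \<inter> {x. f x < c})"
proof (rule ccontr)
  define C where "C = connected_component_set {x\<in>E. f x \<le> c} a"
  define D where "D = C \<inter> {x. f x < c}"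
  have CE: "C \<subseteq> {x\<in>E. f x \<le> c}" unfolding C_def by (rule connected_component_subset)
  assume "\<not> connected (connected_component_set {x\<in>E. f x \<le> c} a \<inter> {x. f x < c})"
  then have "\<not> connected D" by (simp add: C_def D_def)
  then obtain U V where U: "closedin (top_of_set D) U" and V: "closedin (top_of_set D) V"
    and UV: "U \<union> V = D" "U \<inter> V = {}" and ne: "U \<noteq> {}" "V \<noteq> {}"
    unfolding connected_closedin_eq by blast
  have clD: "closure X \<inter> D \<subseteq> X" and clT: "\<And>T. T \<subseteq> D \<Longrightarrow> closedin (top_of_set T) (T \<inter> X)"
    if X: "closedin (top_of_set D) X" for X
  proof -
    obtain K where K: "closed K" "X = D \<inter> K"
      using X by (auto simp: closedin_closed)
    then have "closure X \<subseteq> K" by (simp add: closure_minimal)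
    then show "closure X \<inter> D \<subseteq> X" using K by blast
    fix T assume "T \<subseteq> D"
    then have "T \<inter> X = T \<inter> K" using K by blast
    then show "closedin (top_of_set T) (T \<inter> X)" using K by (simp add: closedin_closed_Int)
  qed
  \<comment> \<open>Since \<open>insert p T\<close> is connected and meets \<open>C\<close>, it lies
    in \<open>C\<close>; hence \<open>T\<close> is part of \<open>D\<close> and, being connected,
    falls on a single side of the separation.\<close>
  have bdry: "\<exists>\<epsilon> T. \<epsilon> > 0 \<and> T \<subseteq> D \<and> D \<inter> ball p \<epsilon> \<subseteq> T \<and> p \<in> closure T \<and> (T \<subseteq> U \<or> T \<subseteq> V)"
    if p: "p \<in> C" "f p = c" for p
  proof -
    have "p \<in> E" using p CE by blast
    from regular[OF this p(2)] obtain \<epsilon> T where T: "\<epsilon> > 0" "connected T" "T \<subseteq> {x\<in>E. f x < c}"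
      "{x\<in>E. f x < c} \<inter> ball p \<epsilon> \<subseteq> T" "p \<in> closure T"
      by blast
    have "connected (insert p T)"
      using T by (intro connected_intermediate_closure[OF \<open>connected T\<close>]) (auto simp: closure_subset[THEN subsetD])
    then have "insert p T \<subseteq> connected_component_set {x\<in>E. f x \<le> c} p"
      using T p CE by (intro connected_component_maximal) auto
    also have "\<dots> = C"
      using p(1) unfolding C_def by (metis connected_component_eq)
    finally have "T \<subseteq> D" using T by (auto simp: D_def)
    moreover have "T \<subseteq> U \<or> T \<subseteq> V"
    proof -
      have "closedin (top_of_set T) (T \<inter> U)" "closedin (top_of_set T) (T \<inter> V)"
        using U V \<open>T \<subseteq> D\<close> clT by auto
      then show ?thesis
        using \<open>connected T\<close> \<open>T \<subseteq> D\<close> UV unfolding connected_closedin by blast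
    qed
    moreover have "D \<inter> ball p \<epsilon> \<subseteq> T" using T CE by (auto simp: D_def)
    ultimately show ?thesis using T by blast
  qed
  have cover: "C \<subseteq> (closure U \<inter> C) \<union> (closure V \<inter> C)"
  proof
    fix p assume p: "p \<in> C"
    show "p \<in> (closure U \<inter> C) \<union> (closure V \<inter> C)"
    proof (cases "f p = c")
      case True
      then show ?thesis using bdry[OF p] p by (metis IntI UnCI closure_mono subsetD)
    next
      case False
      then have "p \<in> D" using p CE by (auto simp: D_def)
      then show ?thesis using UV p closure_subset by blast
    qed
  qed
  \<comment> \<open>At level \<open>c\<close> a small ball meets \<open>D\<close> only inside one
    side, so \<open>p\<close> cannot adhere to both; below level \<open>c\<close> the point lies in
    \<open>D\<close>, where \<open>U\<close> and \<open>V\<close> are relatively closed and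
    disjoint.\<close>
  have disj: "(closure U \<inter> C) \<inter> (closure V \<inter> C) = {}"
  proof (rule ccontr)
    assume "(closure U \<inter> C) \<inter> (closure V \<inter> C) \<noteq> {}"
    then obtain p where p: "p \<in> C" "p \<in> closure U" "p \<in> closure V" by blast
    show False
    proof (cases "f p = c")
      case True
      obtain \<epsilon> T where T: "\<epsilon> > 0" "D \<inter> ball p \<epsilon> \<subseteq> T" "T \<subseteq> U \<or> T \<subseteq> V"
        using bdry[OF p(1) True] by blast
      obtain y z where "y \<in> U" "dist y p < \<epsilon>" "z \<in> V" "dist z p < \<epsilon>"
        using p \<open>\<epsilon> > 0\<close> unfolding closure_approachable by blast
      then have "y \<in> T" "z \<in> T" using T UV by (auto simp: dist_commute)
      then show False using T UV \<open>y \<in> U\<close> \<open>z \<in> V\<close> by blast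
    next
      case False
      then have "p \<in> D" using p CE by (auto simp: D_def)
      then show False using p clD[OF U] clD[OF V] UV by blast
    qed
  qed
  have "U \<subseteq> closure U \<inter> C" "V \<subseteq> closure V \<inter> C"
    using UV closure_subset by (auto simp: D_def)
  moreover have "connected C" by (simp add: C_def)
  moreover have "closedin (top_of_set C) (closure U \<inter> C)" "closedin (top_of_set C) (closure V \<inter> C)"
    by (auto simp: Int_commute closedin_closed_Int)
  ultimately show False
    using cover disj ne unfolding connected_closedin by blast
qed

text \<open>
  Two minimisers are joined inside the sublevel set of a least level.  If that level is not the
  minimum, it is regular, so the joining component stays connected strictly below the level, and a
  path there joins the minimisers inside a smaller sublevel set.
\<close>

lemma connected_minimizers:
  fixes f :: "'a::euclidean_space \<Rightarrow> real"
  assumes E: "subspace E" and G: "continuous_on E G"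
    and deriv: "\<And>x. x \<in> E \<Longrightarrow> (f has_derivative (\<lambda>h. G x \<bullet> h)) (at x within E)"
    and stationary: "\<And>x z. x \<in> E \<Longrightarrow> (f has_derivative (\<lambda>h. 0)) (at x within E) \<Longrightarrow> z \<in> E \<Longrightarrow> f x \<le> f z"
    and compact_sublevel: "\<And>x. x \<in> E \<Longrightarrow> compact {z\<in>E. f z \<le> f x}"
  shows "connected {x\<in>E. \<forall>y\<in>E. f x \<le> f y}"
  unfolding connected_iff_connected_component
proof (intro ballI)
  define M where "M = {x\<in>E. \<forall>y\<in>E. f x \<le> f y}"
  fix a b assume "a \<in> {x\<in>E. \<forall>y\<in>E. f x \<le> f y}" "b \<in> {x\<in>E. \<forall>y\<in>E. f x \<le> f y}"
  then have ab: "a \<in> E" "b \<in> E" and amin: "\<And>y. y \<in> E \<Longrightarrow> f a \<le> f y"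
    and bmin: "\<And>y. y \<in> E \<Longrightarrow> f b \<le> f y" by auto
  have cont: "continuous_on E f"
    by (rule has_derivative_continuous_on[OF deriv])
  define Q where "Q = (\<lambda>c. {x\<in>E. f x \<le> c})"
  \<comment> \<open>The levels at which \<open>a\<close> and \<open>b\<close> can be joined; their
    infimum \<open>c\<close> is the pass level.\<close>
  define J where "J = {c. connected_component (Q c) a b}"
  have joinI: "f x \<in> J \<and> x \<in> K" if "compact K" "connected K" "a \<in> K" "b \<in> K" "K \<subseteq> E"
    "x \<in> K" "\<forall>y\<in>K. f y \<le> f x" for K x
    using that unfolding J_def Q_def connected_component_def by blast
  have top: "\<exists>x\<in>K. f x \<in> J" if K: "compact K" "connected K" "a \<in> K" "b \<in> K" "K \<subseteq> E" for K
  proof -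
    obtain x where "x \<in> K" "\<forall>y\<in>K. f y \<le> f x"
      using continuous_attains_sup[of K f] K continuous_on_subset[OF cont] by blast
    then show ?thesis using joinI K by blast
  qed
  have "closed_segment a b \<subseteq> E"
    using ab E by (simp add: closed_segment_subset subspace_imp_convex)
  then obtain x0 where x0: "x0 \<in> E" "f x0 \<in> J"
    using top[of "closed_segment a b"] by auto
  have Jlow: "f a \<le> c" if "c \<in> J" for c
    using that connected_component_in unfolding J_def Q_def by fastforce
  then have bdd: "bdd_below J" by (meson bdd_belowI)
  define c where "c = Inf J"
  have clow: "f a \<le> c" unfolding c_def using x0 Jlow by (intro cInf_greatest) auto
  \<comment> \<open>The infimum is attained: the nested compact components containing
    \<open>a\<close> and \<open>b\<close> have a connected intersection, and it lies in
    \<open>Q c\<close>. Restricting to levels up to \<open>f x0\<close> puts every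
    \<open>Q d\<close> inside one compact sublevel set.\<close>
  define \<F> where "\<F> = (\<lambda>d. connected_component_set (Q d) a) ` {d\<in>J. d \<le> f x0}"
  have "connected (\<Inter>\<F>)"
  proof (rule connected_chain)
    fix X assume "X \<in> \<F>"
    then obtain d where d: "d \<in> J" "d \<le> f x0" "X = connected_component_set (Q d) a"
      by (auto simp: \<F>_def)
    have "closedin (top_of_set {z\<in>E. f z \<le> f x0}) ({z\<in>E. f z \<le> f x0} \<inter> f -` {..d})"
      by (intro continuous_closedin_preimage continuous_on_subset[OF cont]) auto
    moreover have "{z\<in>E. f z \<le> f x0} \<inter> f -` {..d} = Q d"
      using d by (auto simp: Q_def)
    ultimately have "compact (Q d)"
      using compact_sublevel[OF x0(1)] closedin_compact by metis
    then show "compact X \<and> connected X"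
      using d closedin_compact closedin_connected_component by blast
  next
    fix X Y assume "X \<in> \<F> \<and> Y \<in> \<F>"
    then obtain d e where "X = connected_component_set (Q d) a" "Y = connected_component_set (Q e) a"
      by (auto simp: \<F>_def)
    moreover have "Q d \<subseteq> Q e \<or> Q e \<subseteq> Q d" unfolding Q_def by (cases "d \<le> e") auto
    ultimately show "X \<subseteq> Y \<or> Y \<subseteq> X" using connected_component_mono by metis
  qed
  moreover have "a \<in> \<Inter>\<F>" "b \<in> \<Inter>\<F>"
    using Jlow ab by (auto simp: \<F>_def J_def Q_def)
  moreover have "\<Inter>\<F> \<subseteq> Q c"
  proof
    fix x assume x: "x \<in> \<Inter>\<F>"
    have xQ: "x \<in> Q d" if "d \<in> J" "d \<le> f x0" for d
      using x that connected_component_subset unfolding \<F>_def by fast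
    have "x \<in> E" "f x \<le> f x0" using xQ[of "f x0"] x0 by (auto simp: Q_def)
    moreover have "f x \<le> d" if "d \<in> J" for d
      using xQ[of d] that \<open>f x \<le> f x0\<close> by (cases "d \<le> f x0") (auto simp: Q_def)
    then have "f x \<le> c" unfolding c_def using x0 by (intro cInf_greatest) auto
    ultimately show "x \<in> Q c" by (simp add: Q_def)
  qed
  ultimately have abc: "connected_component (Q c) a b"
    unfolding connected_component_def by blast
  \<comment> \<open>Above the minimum, level \<open>c\<close> contains no stationary point, so
    \<open>a\<close> and \<open>b\<close> would remain joined strictly below
    \<open>c\<close>.\<close>
  have "c = f a"
  proof (rule ccontr)
    assume "c \<noteq> f a"
    then have ac: "f a < c" using clow by simp
    have bc: "f b < c" using ac bmin[OF ab(1)] by simp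
    define D where "D = connected_component_set (Q c) a \<inter> {x. f x < c}"
    define O' where "O' = {x\<in>E. f x < c}"
    have "connected D" unfolding D_def Q_def
    proof (rule connected_strict_sublevel_component)
      fix p assume p: "p \<in> E" "f p = c"
      then have "\<not> (f has_derivative (\<lambda>h. 0)) (at p within E)"
        using stationary[of p a] ac ab by auto
      from strict_sublevel_near_regular_point[OF E G deriv p(1) this]
      obtain \<epsilon> T where "\<epsilon> > 0" "connected T" "T \<subseteq> {x\<in>E. f x < f p}"
        "{x\<in>E. f x < f p} \<inter> ball p \<epsilon> \<subseteq> T" "p \<in> closure T" by blast
      then show "\<exists>\<epsilon> T. \<epsilon> > 0 \<and> connected T \<and> T \<subseteq> {x\<in>E. f x < c} \<and>
          {x\<in>E. f x < c} \<inter> ball p \<epsilon> \<subseteq> T \<and> p \<in> closure T"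
        using p(2) by blast
    qed
    moreover have "D \<subseteq> O'"
      using connected_component_subset[of "Q c" a] by (auto simp: D_def O'_def Q_def)
    moreover have "a \<in> D" "b \<in> D"
      using abc ac bc ab by (auto simp: D_def Q_def)
    ultimately have "connected_component O' a b"
      unfolding connected_component_def by blast
    \<comment> \<open>Being joined strictly below \<open>c\<close> does not yet give a smaller
      level. Openness in \<open>E\<close> upgrades connectedness to a path, whose compact image
      attains a maximum of \<open>f\<close>: a level in \<open>J\<close> below its infimum.\<close>
    moreover have "locally path_connected O'"
    proof (rule locally_open_subset)
      show "locally path_connected E"
        using E by (intro convex_imp_locally_path_connected subspace_imp_convex)
      have "openin (top_of_set E) (E \<inter> f -` {..<c})"
        by (intro continuous_openin_preimage_gen cont) auto
      then show "openin (top_of_set E) O'"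
        by (simp add: O'_def vimage_def Int_def)
    qed
    ultimately have "path_component O' a b"
      by (simp add: path_component_eq_connected_component)
    then obtain g where g: "path g" "path_image g \<subseteq> O'" "pathstart g = a" "pathfinish g = b"
      unfolding path_component_def by blast
    then obtain x where "x \<in> path_image g" "f x \<in> J"
      using top[of "path_image g"] connected_path_image compact_path_image
      by (metis (no_types, lifting) O'_def mem_Collect_eq pathfinish_in_path_image
          pathstart_in_path_image subset_iff)
    then have "f x < c" "c \<le> f x"
      using g cInf_lower[OF _ bdd] by (auto simp: O'_def c_def)
    then show False by simp
  qed
  then have "Q c = {x\<in>E. \<forall>y\<in>E. f x \<le> f y}"
    using amin ab by (force simp: Q_def)
  with abc show "connected_component {x\<in>E. \<forall>y\<in>E. f x \<le> f y} a b" by simp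
qed

section \<open>Upper hemicontinuity and unions of connected values\<close>

text \<open>
  Around each parameter the minimisers stay in any neighbourhood of the minimisers for that
  parameter: a minimiser over a compact neighbourhood is a local one, hence global by hypothesis,
  and connectedness keeps the other minimisers from lying beyond its boundary.
\<close>

lemma upper_hemicontinuous_minimizers:
  fixes \<phi> :: "'b::topological_space \<Rightarrow> 'a::euclidean_space \<Rightarrow> real"
    and E :: "'a set"
  defines "M \<equiv> \<lambda>a. {x\<in>E. \<forall>y\<in>E. \<phi> a x \<le> \<phi> a y}"
  assumes E: "closed E" and cont: "continuous_on (P \<times> E) (\<lambda>(a, x). \<phi> a x)"
    and compact: "\<And>a. a \<in> P \<Longrightarrow> compact (M a)"
    and nonempty: "\<And>a. a \<in> P \<Longrightarrow> M a \<noteq> {}"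
    and connected: "\<And>a. a \<in> P \<Longrightarrow> connected (M a)"
    and local_min: "\<And>a p N. a \<in> P \<Longrightarrow> p \<in> E \<Longrightarrow> open N \<Longrightarrow> p \<in> N \<Longrightarrow>
      (\<And>y. y \<in> E \<inter> N \<Longrightarrow> \<phi> a p \<le> \<phi> a y) \<Longrightarrow> p \<in> M a"
    and a: "a \<in> P" and U: "open U" "M a \<subseteq> U"
  obtains X where "open X" "a \<in> X" "\<And>a'. a' \<in> X \<inter> P \<Longrightarrow> M a' \<subseteq> U"
proof -
  obtain e where "e > 0" and e: "{x. infdist x (M a) \<le> e} \<subseteq> U"
    using compact_in_open_separated[OF nonempty[OF a] compact[OF a] U] by blast
  define d where "d = (\<lambda>x. infdist x (M a))"
  have cont_d: "continuous_on A d" for A unfolding d_def by (intro continuous_intros)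
  \<comment> \<open>\<open>L\<close> is the closed \<open>e\<close>-neighbourhood of
    \<open>M a\<close> in \<open>E\<close>, and \<open>F\<close> is the shell at distance exactly
    \<open>e\<close>; both are compact.\<close>
  define L where "L = E \<inter> {x. d x \<le> e}"
  define F where "F = E \<inter> {x. d x = e}"
  have cL: "compact L" unfolding L_def d_def
    using compact_infdist_le[OF nonempty[OF a] compact[OF a] \<open>e > 0\<close>] E by (simp add: closed_Int_compact)
  have "F = L \<inter> F" by (auto simp: F_def L_def)
  have "closed F" unfolding F_def
    using E cont_d by (intro closed_Int closed_Collect_eq) auto
  then have cF: "compact F"
    using compact_Int_closed[OF cL] \<open>F = L \<inter> F\<close> by metis
  obtain x0 where x0: "x0 \<in> M a" using nonempty[OF a] by blast
  have dM: "d x = 0" if "x \<in> M a" for x using that by (simp add: d_def)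
  have x0E: "x0 \<in> E" using x0 by (simp add: M_def)
  \<comment> \<open>\<open>x0\<close> is one fixed competitor for all parameters. That it beats
    \<open>x\<close> at \<open>a'\<close> is a relatively open condition on the pair; it holds on
    \<open>{a} \<times> F\<close>, and the tube lemma extends it to the compact shell
    \<open>F\<close> for all \<open>a'\<close> in \<open>P\<close> near \<open>a\<close>.\<close>
  have "continuous_on (P \<times> E) (\<lambda>z. \<phi> (fst z) (snd z) - \<phi> (fst z) x0)"
  proof (intro continuous_on_diff)
    show "continuous_on (P \<times> E) (\<lambda>z. \<phi> (fst z) (snd z))"
      using cont by (simp add: case_prod_unfold)
    have "continuous_on (P \<times> E) ((\<lambda>(a, x). \<phi> a x) \<circ> (\<lambda>z. (fst z, x0)))"
      using x0E by (intro continuous_on_compose continuous_intros continuous_on_subset[OF cont]) auto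
    then show "continuous_on (P \<times> E) (\<lambda>z. \<phi> (fst z) x0)" by (simp add: o_def)
  qed
  then have "openin (top_of_set (P \<times> E))
      ((P \<times> E) \<inter> (\<lambda>z. \<phi> (fst z) (snd z) - \<phi> (fst z) x0) -` {0<..})"
    by (intro continuous_openin_preimage_gen) auto
  then obtain W where "open W" and
    W: "(P \<times> E) \<inter> (\<lambda>z. \<phi> (fst z) (snd z) - \<phi> (fst z) x0) -` {0<..} = (P \<times> E) \<inter> W"
    by (auto simp: openin_open)
  have W_iff: "(a', x) \<in> W \<longleftrightarrow> \<phi> a' x0 < \<phi> a' x" if "a' \<in> P" "x \<in> E" for a' x
    using W that unfolding set_eq_iff by (auto dest: spec[of _ "(a', x)"])
  have "\<phi> a x0 < \<phi> a x" if "x \<in> F" for x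
  proof -
    have "x \<in> E" "x \<notin> M a" using that dM[of x] \<open>e > 0\<close> by (auto simp: F_def)
    then obtain y where "y \<in> E" "\<phi> a y < \<phi> a x" by (force simp: M_def)
    moreover have "\<phi> a x0 \<le> \<phi> a y" using x0 \<open>y \<in> E\<close> by (simp add: M_def)
    ultimately show ?thesis by simp
  qed
  then have "{a} \<times> F \<subseteq> W" using W_iff a by (auto simp: F_def)
  then obtain X where X: "a \<in> X" "open X" "X \<times> F \<subseteq> W"
    using Elementary_Topology.tube_lemma[OF cF \<open>open W\<close>] by blast
  show ?thesis
  proof
    fix a' assume a': "a' \<in> X \<inter> P"
    then have "a' \<in> P" by simp
    have F: "\<phi> a' x0 < \<phi> a' x" if "x \<in> F" for x
      using X a' that W_iff[OF \<open>a' \<in> P\<close>, of x] by (auto simp: F_def)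
    then have MF: "M a' \<inter> F = {}" using x0E by (force simp: M_def)
    have "continuous_on L ((\<lambda>(a, x). \<phi> a x) \<circ> (\<lambda>x. (a', x)))"
      using \<open>a' \<in> P\<close> by (intro continuous_on_compose continuous_intros continuous_on_subset[OF cont])
        (auto simp: L_def)
    moreover have x0L: "x0 \<in> L" using x0E dM[OF x0] \<open>e > 0\<close> by (simp add: L_def)
    ultimately obtain p where p: "p \<in> L" "\<And>y. y \<in> L \<Longrightarrow> \<phi> a' p \<le> \<phi> a' y"
      using continuous_attains_inf[OF cL, of "\<phi> a'"] by (auto simp: o_def)
    \<comment> \<open>On the shell \<open>x0\<close> does better, so the minimum over
      \<open>L\<close> is taken at distance less than \<open>e\<close>, which makes \<open>p\<close>
      a local minimiser relative to \<open>E\<close>.\<close>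
    have "p \<notin> F" using F p(2)[OF x0L] by force
    then have dp: "p \<in> E" "d p < e" using p(1) by (auto simp: L_def F_def)
    have "open {x. d x < e}"
      using cont_d by (intro open_Collect_less) auto
    then have "p \<in> M a'"
      using dp p by (intro local_min[OF \<open>a' \<in> P\<close>, of p "{x. d x < e}"]) (auto simp: L_def)
    \<comment> \<open>The values of \<open>d\<close> on \<open>M a'\<close> form an interval that
      contains \<open>d p < e\<close> and misses \<open>e\<close>, because \<open>M a'\<close>
      avoids the shell; so none exceeds \<open>e\<close>.\<close>
    have "connected (d ` M a')"
      using connected[OF \<open>a' \<in> P\<close>] cont_d by (intro connected_continuous_image)
    have "d x \<le> e" if "x \<in> M a'" for x
    proof (rule ccontr)
      assume "\<not> d x \<le> e"
      then have "e \<in> d ` M a'"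
        using connectedD_interval[OF \<open>connected (d ` M a')\<close>, of "d p" "d x" e] dp that \<open>p \<in> M a'\<close>
        by auto
      then show False using MF by (auto simp: F_def M_def)
    qed
    then show "M a' \<subseteq> U" using e by (auto simp: d_def)
  qed (use X in auto)
qed

text \<open>If two open sets separated the union, each connected value would lie on one side.
  Nonemptiness makes the two classes of parameters disjoint and upper hemicontinuity makes them
  relatively open, so they would separate \<open>S\<close>.\<close>

lemma connected_UN_upper_hemicontinuous:
  fixes M :: "'b::topological_space \<Rightarrow> 'a::topological_space set"
  assumes S: "connected S"
    and connected: "\<And>a. a \<in> S \<Longrightarrow> connected (M a)"
    and nonempty: "\<And>a. a \<in> S \<Longrightarrow> M a \<noteq> {}"
    and uhc: "\<And>a U. a \<in> S \<Longrightarrow> open U \<Longrightarrow> M a \<subseteq> U \<Longrightarrow>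
      \<exists>X. open X \<and> a \<in> X \<and> (\<forall>a'\<in>X \<inter> S. M a' \<subseteq> U)"
  shows "connected (\<Union>a\<in>S. M a)"
proof (rule connectedI)
  fix U V assume UV: "open U" "open V" "U \<inter> (\<Union>a\<in>S. M a) \<noteq> {}" "V \<inter> (\<Union>a\<in>S. M a) \<noteq> {}"
    "U \<inter> V \<inter> (\<Union>a\<in>S. M a) = {}" "(\<Union>a\<in>S. M a) \<subseteq> U \<union> V"
  have split: "M a \<subseteq> U \<or> M a \<subseteq> V" if "a \<in> S" for a
  proof (rule ccontr)
    assume "\<not> (M a \<subseteq> U \<or> M a \<subseteq> V)"
    moreover have "M a \<subseteq> U \<union> V" "U \<inter> V \<inter> M a = {}" using UV that by blast+
    ultimately have "U \<inter> M a \<noteq> {}" "V \<inter> M a \<noteq> {}" by blast+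
    then show False
      using connectedD[OF connected[OF that] UV(1,2)] \<open>M a \<subseteq> U \<union> V\<close> \<open>U \<inter> V \<inter> M a = {}\<close> by blast
  qed
  have opens: "openin (top_of_set S) {a\<in>S. M a \<subseteq> Y}" if Y: "open Y" for Y
  proof (subst openin_subopen, intro ballI)
    fix a assume a: "a \<in> {a\<in>S. M a \<subseteq> Y}"
    then obtain X where "open X" "a \<in> X" "\<forall>a'\<in>X \<inter> S. M a' \<subseteq> Y"
      using uhc[OF _ Y] by blast
    then show "\<exists>T. openin (top_of_set S) T \<and> a \<in> T \<and> T \<subseteq> {a\<in>S. M a \<subseteq> Y}"
      using a by (intro exI[of _ "S \<inter> X"]) (auto simp: openin_open_Int)
  qed
  have "S \<subseteq> {a\<in>S. M a \<subseteq> U} \<union> {a\<in>S. M a \<subseteq> V}" using split by blast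
  moreover have "{a\<in>S. M a \<subseteq> U} \<inter> {a\<in>S. M a \<subseteq> V} = {}" using UV(5) nonempty by blast
  moreover have "{a\<in>S. M a \<subseteq> U} \<noteq> {}" "{a\<in>S. M a \<subseteq> V} \<noteq> {}"
    using split UV(3-5) by blast+
  ultimately show False
    using S opens[OF UV(1)] opens[OF UV(2)] unfolding connected_openin by blast
qed

lemma connected_Pi_UNIV:
  fixes A :: "'n \<Rightarrow> 'b::topological_space set"
  assumes "\<And>i. connected (A i)"
  shows "connected (Pi UNIV A)"
proof -
  have "connectedin (product_topology (\<lambda>i. euclidean) UNIV) (PiE UNIV A)"
    using assms unfolding connectedin_PiE by simp
  then show ?thesis
    by (simp add: euclidean_product_topology PiE_UNIV_domain)
qed

section \<open>Best responses in an incave game, treated as minimisers of the negated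
  utility\<close>

lemma subspace_coord_space: "subspace (coord_space J)"
  by (auto simp: subspace_def coord_space_def)

text \<open>Joint continuity feeds upper hemicontinuity across opponent profiles; continuous
  differentiability in the own action supplies the gradient field for the descent argument. Both are
  assumed on top of \<open>incave_game\<close>.\<close>

context
  fixes I :: "'n::finite \<Rightarrow> 'm::finite set"
    and u :: "'n \<Rightarrow> ('n \<Rightarrow> real ^ 'm) \<Rightarrow> real"
  assumes continuous_utilities: "\<And>i. continuous_on (joint_actions I) (u i)"
    and C1_in_own_action: "\<And>i a. a \<in> joint_actions I \<Longrightarrow>
      continuously_differentiable_on (coord_space (I i)) (\<lambda>x. u i (a(i := x)))"
    and incave: "incave_game I u"
begin

lemma best_response_eq_minimizers:
  "best_response I u i a =
    {x\<in>coord_space (I i). \<forall>y\<in>coord_space (I i). - u i (a(i := x)) \<le> - u i (a(i := y))}"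
  by (simp add: best_response_def)

lemma gradient_of_negated_utility:
  assumes "a \<in> joint_actions I"
  obtains G where "continuous_on (coord_space (I i)) G"
    "\<And>x. x \<in> coord_space (I i) \<Longrightarrow>
      ((\<lambda>x. - u i (a(i := x))) has_derivative (\<lambda>h. G x \<bullet> h)) (at x within coord_space (I i))"
proof -
  obtain G where G: "continuous_on (coord_space (I i)) G"
    "\<And>x. x \<in> coord_space (I i) \<Longrightarrow>
      ((\<lambda>x. u i (a(i := x))) has_derivative (\<lambda>h. G x \<bullet> h)) (at x within coord_space (I i))"
    using C1_in_own_action[OF assms] unfolding continuously_differentiable_on_def by blast
  show ?thesis
  proof
    show "continuous_on (coord_space (I i)) (\<lambda>x. - G x)" using G by (intro continuous_intros)
    fix x assume "x \<in> coord_space (I i)"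
    from has_derivative_minus[OF G(2)[OF this]]
    show "((\<lambda>x. - u i (a(i := x))) has_derivative (\<lambda>h. - G x \<bullet> h)) (at x within coord_space (I i))"
      by simp
  qed
qed

lemma stationary_imp_minimizer:
  assumes "a \<in> joint_actions I" "x \<in> coord_space (I i)"
    "((\<lambda>x. - u i (a(i := x))) has_derivative (\<lambda>h. 0)) (at x within coord_space (I i))"
    "z \<in> coord_space (I i)"
  shows "- u i (a(i := x)) \<le> - u i (a(i := z))"
  using incave assms
  unfolding incave_game_def incave_on_def invex_on_def stationary_on_def by blast

text \<open>Decrease at infinity confines this set to a compact \<open>K\<close>, in which
  continuity makes it closed.\<close>

lemma compact_sublevel_negated_utility:
  assumes a: "a \<in> joint_actions I" and x: "x \<in> coord_space (I i)"
  shows "compact {z\<in>coord_space (I i). - u i (a(i := z)) \<le> - u i (a(i := x))}"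
proof -
  define E where "E = coord_space (I i)"
  obtain G where "\<And>x. x \<in> E \<Longrightarrow>
      ((\<lambda>x. - u i (a(i := x))) has_derivative (\<lambda>h. G x \<bullet> h)) (at x within E)"
    using gradient_of_negated_utility[OF a] unfolding E_def by blast
  then have cont: "continuous_on E (\<lambda>x. - u i (a(i := x)))"
    by (rule has_derivative_continuous_on)
  obtain K where K: "K \<subseteq> E" "compact K" "\<forall>z\<in>E - K. u i (a(i := z)) < u i (a(i := x))"
    using incave a x unfolding incave_game_def decreasing_at_infinity_on_def E_def by blast
  have "closedin (top_of_set K) (K \<inter> (\<lambda>x. - u i (a(i := x))) -` {..- u i (a(i := x))})"
    using K by (intro continuous_closedin_preimage continuous_on_subset[OF cont]) auto
  moreover have "K \<inter> (\<lambda>x. - u i (a(i := x))) -` {..- u i (a(i := x))} =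
      {z\<in>E. - u i (a(i := z)) \<le> - u i (a(i := x))}"
  proof -
    have "z \<in> K" if "z \<in> E" "u i (a(i := x)) \<le> u i (a(i := z))" for z
      using K(3) that linorder_not_less by blast
    then show ?thesis using K(1) by auto
  qed
  ultimately show ?thesis using closedin_compact[OF K(2)] by (simp add: E_def)
qed

lemma best_response_connected:
  assumes "a \<in> joint_actions I"
  shows "connected (best_response I u i a)"
proof -
  obtain G where "continuous_on (coord_space (I i)) G" "\<And>x. x \<in> coord_space (I i) \<Longrightarrow>
      ((\<lambda>x. - u i (a(i := x))) has_derivative (\<lambda>h. G x \<bullet> h)) (at x within coord_space (I i))"
    using gradient_of_negated_utility[OF assms] by blast
  then show ?thesis
    unfolding best_response_eq_minimizers
    using stationary_imp_minimizer[OF assms] compact_sublevel_negated_utility[OF assms]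
    by (intro connected_minimizers[OF subspace_coord_space]) blast+
qed

text \<open>The action \<open>0\<close> lies in every coordinate space. The sublevel set through it
  is compact, so the minimum there is attained, and values outside exceed the one at
  \<open>0\<close>.\<close>

lemma best_response_nonempty:
  assumes a: "a \<in> joint_actions I"
  shows "best_response I u i a \<noteq> {}"
proof -
  define E where "E = coord_space (I i)"
  define f where "f = (\<lambda>x. - u i (a(i := x)))"
  define L where "L = {z\<in>E. f z \<le> f 0}"
  have "0 \<in> E" using subspace_0[OF subspace_coord_space] by (simp add: E_def)
  then have L: "compact L" "0 \<in> L"
    using compact_sublevel_negated_utility[OF a] by (auto simp: E_def L_def f_def)
  obtain G where "\<And>x. x \<in> E \<Longrightarrow> (f has_derivative (\<lambda>h. G x \<bullet> h)) (at x within E)"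
    using gradient_of_negated_utility[OF a] unfolding E_def f_def by blast
  then have "continuous_on E f" by (rule has_derivative_continuous_on)
  then have "continuous_on L f" by (rule continuous_on_subset) (auto simp: L_def)
  then obtain x where x: "x \<in> L" "\<forall>y\<in>L. f x \<le> f y"
    using continuous_attains_inf[of L f] L by blast
  have "f x \<le> f y" if "y \<in> E" for y
    using x L that by (cases "f y \<le> f 0") (auto simp: L_def)
  then have "x \<in> best_response I u i a"
    using x unfolding best_response_eq_minimizers L_def f_def E_def by simp
  then show ?thesis by blast
qed

text \<open>Once one best response \<open>x\<close> is known, the best responses are exactly the
  sublevel set at its value.\<close>

lemma best_response_compact:
  assumes a: "a \<in> joint_actions I"
  shows "compact (best_response I u i a)"
proof -
  obtain x where x: "x \<in> best_response I u i a" using best_response_nonempty[OF a] by blast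
  then have "best_response I u i a = {z\<in>coord_space (I i). - u i (a(i := z)) \<le> - u i (a(i := x))}"
    unfolding best_response_def by (auto intro: order_trans)
  moreover have "x \<in> coord_space (I i)" using x by (simp add: best_response_def)
  ultimately show ?thesis using compact_sublevel_negated_utility[OF a] by simp
qed

text \<open>By incavity, an action that is not a best response is not stationary, so actions of
  strictly higher utility accumulate at it; a local maximiser allows none.\<close>

lemma local_minimizer_imp_best_response:
  assumes a: "a \<in> joint_actions I" and p: "p \<in> coord_space (I i)" and N: "open N" "p \<in> N"
    and le: "\<And>y. y \<in> coord_space (I i) \<inter> N \<Longrightarrow> - u i (a(i := p)) \<le> - u i (a(i := y))"
  shows "p \<in> best_response I u i a"
proof (rule ccontr)
  assume "p \<notin> best_response I u i a"
  then have nonstat: "\<not> ((\<lambda>x. - u i (a(i := x))) has_derivative (\<lambda>h. 0)) (at p within coord_space (I i))"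
    using stationary_imp_minimizer[OF a p] p unfolding best_response_eq_minimizers by blast
  obtain G where G: "continuous_on (coord_space (I i)) G" "\<And>x. x \<in> coord_space (I i) \<Longrightarrow>
      ((\<lambda>x. - u i (a(i := x))) has_derivative (\<lambda>h. G x \<bullet> h)) (at x within coord_space (I i))"
    using gradient_of_negated_utility[OF a] by blast
  obtain \<epsilon> T where "\<epsilon> > 0" "connected T"
    and T1: "T \<subseteq> {x\<in>coord_space (I i). - u i (a(i := x)) < - u i (a(i := p))}"
    and "{x\<in>coord_space (I i). - u i (a(i := x)) < - u i (a(i := p))} \<inter> ball p \<epsilon> \<subseteq> T"
    and T2: "p \<in> closure T"
    using strict_sublevel_near_regular_point[OF subspace_coord_space G p nonstat] .
  obtain y where "y \<in> T" "y \<in> N"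
    using T2 N by (metis IntE closure_iff_nhds_not_empty disjoint_iff order_refl)
  then show False using le[of y] T1 by force
qed

text \<open>The update is continuous in each coordinate of the product and stays inside
  \<open>joint_actions I\<close>, so joint continuity of the utility applies.\<close>

lemma continuous_on_utility_update:
  "continuous_on (joint_actions I \<times> coord_space (I i)) (\<lambda>(a, x). - u i (a(i := x)))"
proof -
  have "continuous_on (joint_actions I \<times> coord_space (I i)) (\<lambda>z. (fst z)(i := snd z))"
  proof (rule continuous_on_coordinatewise_then_product)
    fix j
    have "continuous_on (joint_actions I \<times> coord_space (I i)) (\<lambda>z. fst z j)"
      by (rule continuous_on_product_then_coordinatewise[OF continuous_on_fst[OF continuous_on_id]])
    then show "continuous_on (joint_actions I \<times> coord_space (I i)) (\<lambda>z. ((fst z)(i := snd z)) j)"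
      by (cases "j = i") (auto intro!: continuous_intros)
  qed
  moreover have "(fst z)(i := snd z) \<in> joint_actions I" if "z \<in> joint_actions I \<times> coord_space (I i)" for z
    using that by (auto simp: joint_actions_def)
  ultimately have "continuous_on (joint_actions I \<times> coord_space (I i)) (\<lambda>z. u i ((fst z)(i := snd z)))"
    by (intro continuous_on_compose2[OF continuous_utilities]) auto
  then show ?thesis by (simp add: case_prod_unfold continuous_on_minus)
qed

text \<open>Upper hemicontinuity is obtained over all of \<open>joint_actions I\<close> and then
  restricted to \<open>S\<close>.\<close>

lemma connected_UN_best_response:
  assumes S: "S \<subseteq> joint_actions I" "connected S"
  shows "connected (\<Union>a\<in>S. best_response I u i a)"
proof (rule connected_UN_upper_hemicontinuous[OF S(2)])
  fix a U assume a: "a \<in> S" and U: "open U" "best_response I u i a \<subseteq> U"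
  have cl: "closed (coord_space (I i))" by (rule closed_subspace[OF subspace_coord_space])
  show "\<exists>X. open X \<and> a \<in> X \<and> (\<forall>a'\<in>X \<inter> S. best_response I u i a' \<subseteq> U)"
  proof (rule upper_hemicontinuous_minimizers[where E = "coord_space (I i)" and a = a and U = U
        and \<phi> = "\<lambda>a x. - u i (a(i := x))" and P = "joint_actions I",
        folded best_response_eq_minimizers, OF cl continuous_on_utility_update])
    show "\<And>a. a \<in> joint_actions I \<Longrightarrow> compact (best_response I u i a)"
      by (rule best_response_compact)
    show "\<And>a. a \<in> joint_actions I \<Longrightarrow> best_response I u i a \<noteq> {}"
      by (rule best_response_nonempty)
    show "\<And>a. a \<in> joint_actions I \<Longrightarrow> connected (best_response I u i a)"
      by (rule best_response_connected)
    show "p \<in> best_response I u i a" if "a \<in> joint_actions I" "p \<in> coord_space (I i)" "open N" "p \<in> N"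
      "\<And>y. y \<in> coord_space (I i) \<inter> N \<Longrightarrow> - u i (a(i := p)) \<le> - u i (a(i := y))" for a p N
      using that by (rule local_minimizer_imp_best_response)
    show "a \<in> joint_actions I" using a S(1) by blast
    fix X assume "open X" "a \<in> X" "\<And>a'. a' \<in> X \<inter> joint_actions I \<Longrightarrow> best_response I u i a' \<subseteq> U"
    then show ?thesis using S(1) by blast
  qed (use U in auto)
qed (use S best_response_connected best_response_nonempty in blast)+

lemma connected_joint_best_response:
  assumes "S \<subseteq> joint_actions I" "connected S"
  shows "connected (joint_best_response I u S)"
  unfolding joint_best_response_def
  by (intro connected_Pi_UNIV connected_UN_best_response assms)

end

section \<open>Iterating the joint best response map\<close>

text \<open>Keeps the iteration where the connectedness result applies.\<close>

lemma joint_best_response_subset: "joint_best_response I u S \<subseteq> joint_actions I"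
  by (force simp: joint_best_response_def joint_actions_def best_response_def)

theorem proposition5:
  fixes I :: "'n::finite \<Rightarrow> 'm::finite set"
    and u :: "'n \<Rightarrow> ('n \<Rightarrow> real ^ 'm) \<Rightarrow> real"
    and S :: "('n \<Rightarrow> real ^ 'm) set"
    and k :: nat
  assumes continuous_utilities: "\<And>i. continuous_on (joint_actions I) (u i)"
    and C1_in_own_action: "\<And>i a. a \<in> joint_actions I \<Longrightarrow>
      continuously_differentiable_on (coord_space (I i)) (\<lambda>x. u i (a(i := x)))"
    and incave: "incave_game I u"
    and S_subset: "S \<subseteq> joint_actions I"
    and S_connected: "connected S"
    and k_pos: "k \<ge> 1"
  shows "connected (rationalizable I u S k)"
proof -
  \<comment> \<open>Containment in \<open>joint_actions I\<close> is carried along because each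
    further application of the map relies on it; the base case is \<open>S\<close> itself.\<close>
  have "(joint_best_response I u ^^ k) S \<subseteq> joint_actions I \<and> connected ((joint_best_response I u ^^ k) S)"
  proof (induction k)
    case 0
    show ?case using S_subset S_connected by simp
  next
    case (Suc k)
    then show ?case
      using connected_joint_best_response[OF continuous_utilities C1_in_own_action incave]
      by (auto simp: joint_best_response_subset[THEN subsetD])
  qed
  then show ?thesis by (simp add: rationalizable_def)
qed

end
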